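(* In the noiseless setting, where the measurement vector is $y=B_S\alpha$, there is a linear estimator $\widehat F=w^Ty$ with $w\in\mathbb{R}^{r|S|}$ that recovers the target, i.e. satisfies $w^TB_S\alpha=F_{\tau,c}(U_K\alpha)$ for every $\alpha\in\mathbb{R}^K$, if and only if $$g_{\tau,c}\in\operatorname{range}(B_S^T).$$ Equivalently, exact recovery holds if and only if there exists $w\in\mathbb{R}^{r|S|}$ such that $B_S^Tw=g_{\tau,c}$.
   Context: Let $G=(V,E,\omega)$ be a finite, undirected, connected graph with $n=|V|$ vertices and edge weights $\omega_{uv}>0$ for $\{u,v\}\in E$. Let $W$ be the weighted adjacency matrix ($W_{uv}=\omega_{uv}$ if $\{u,v\}\in E$, and $0$ otherwise), $D$ the diagonal matrix of weighted degrees $D_{vv}=\sum_u W_{uv}$, and $L=D-W$ the unnormalized weighted Laplacian. Fix an orthogonal eigendecomposition $L=U\Lambda U^T$, with orthonormal eigenvector columns $\phi_0,\ldots,\phi_{n-1}$ of $U$ and eigenvalues $0=\lambda_0<\lambda_1\le\cdots\le\lambda_{n-1}$; $\phi_\ell(v)$ is the entry of $\phi_\ell$ at vertex $v$. Fix a retained bandwidth $K$ with $1\le K\le n$, and set $U_K=[\phi_0\ \cdots\ \phi_{K-1}]$, $\Lambda_K=\operatorname{diag}(\lambda_0,\ldots,\lambda_{K-1})$. A retained initial state $x_0=U_K\alpha$, $\alpha\in\mathbb{R}^K$, evolves by $x(t)=e^{-tL}x_0=U_Ke^{-t\Lambda_K}\alpha$. Fix a prediction horizon $\tau>0$ and observation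 times $0\le t_1<\cdots<t_r<\tau$. For a vertex $v$, the measurement block is the matrix $R_v\in\mathbb{R}^{r\times K}$ with entries $R_v(j,\ell)=e^{-t_j\lambda_\ell}\phi_\ell(v)$, $j=1,\ldots,r$, $\ell=0,\ldots,K-1$. For a set of vertices $S=\{v_1,\ldots,v_m\}\subseteq V$ (permanent locations), $B_S\in\mathbb{R}^{rm\times K}$ is the matrix obtained by stacking $R_{v_1},\ldots,R_{v_m}$ vertically. Let $c\in\mathbb{R}^n$ with $c\ge 0$ entrywise and $\mathbf{1}^Tc=1$. The target functional is $F_{\tau,c}(x_0):=c^Tx(\tau)=g_{\tau,c}^T\alpha$, where $g_{\tau,c}:=e^{-\tau\Lambda_K}U_K^Tc\in\mathbb{R}^K$. *)

theory Defs
  imports Complex_Main "Jordan_Normal_Form.Matrix"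
begin

definition connected_graph :: "'v set \<Rightarrow> 'v set set \<Rightarrow> bool" where
  "connected_graph V E \<longleftrightarrow>
     finite V \<and> V \<noteq> {} \<and>
     E \<subseteq> {{u, v} | u v. u \<in> V \<and> v \<in> V \<and> u \<noteq> v} \<and>
     (\<forall>u\<in>V. \<forall>v\<in>V. (u, v) \<in> {(x, y). {x, y} \<in> E}\<^sup>*)"

text \<open>
  Matrices have natural-number indices, so the vertices are numbered by a bijection
  \<open>vtx\<close> from \<open>{..<n}\<close> to the vertex set: row (or column) \<open>i\<close> belongs to the
  vertex \<open>vtx i\<close>. Weights are attached to edges, i.e. to unordered pairs.
\<close>

definition adjacency_mat ::
  "nat \<Rightarrow> (nat \<Rightarrow> 'v) \<Rightarrow> 'v set set \<Rightarrow> ('v set \<Rightarrow> real) \<Rightarrow> real mat" where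
  "adjacency_mat n vtx E \<omega> =
     mat n n (\<lambda>(i, j). if {vtx i, vtx j} \<in> E then \<omega> {vtx i, vtx j} else 0)"

definition degree_mat ::
  "nat \<Rightarrow> (nat \<Rightarrow> 'v) \<Rightarrow> 'v set set \<Rightarrow> ('v set \<Rightarrow> real) \<Rightarrow> real mat" where
  "degree_mat n vtx E \<omega> =
     mat_diag n (\<lambda>j. \<Sum>i<n. adjacency_mat n vtx E \<omega> $$ (i, j))"

definition laplacian_mat ::
  "nat \<Rightarrow> (nat \<Rightarrow> 'v) \<Rightarrow> 'v set set \<Rightarrow> ('v set \<Rightarrow> real) \<Rightarrow> real mat" where
  "laplacian_mat n vtx E \<omega> = degree_mat n vtx E \<omega> - adjacency_mat n vtx E \<omega>"

text \<open>
  Exponential of a square matrix, the entrywise sum of the power series (which always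
  converges absolutely).
\<close>

definition mat_exp :: "real mat \<Rightarrow> real mat" where
  "mat_exp A = mat (dim_row A) (dim_row A) (\<lambda>(i, j). \<Sum>k. (A ^\<^sub>m k) $$ (i, j) / fact k)"

definition mat_range :: "real mat \<Rightarrow> real vec set" where
  "mat_range A = (\<lambda>x. A *\<^sub>v x) ` carrier_vec (dim_col A)"

text \<open>
  An eigendecomposition \<open>L = U \<Lambda> U\<^sup>T\<close> with \<open>U\<close> orthogonal and
  \<open>\<Lambda> = diag (lam 0, \<dots>, lam (n - 1))\<close>, the eigenvalues being ordered as
  \<open>0 = lam 0 < lam 1 \<le> \<dots> \<le> lam (n - 1)\<close>. Values of \<open>lam\<close> at or beyond
  \<open>n\<close> are irrelevant.
\<close>

definition ordered_eigendecomposition ::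
  "nat \<Rightarrow> real mat \<Rightarrow> real mat \<Rightarrow> (nat \<Rightarrow> real) \<Rightarrow> bool" where
  "ordered_eigendecomposition n L U lam \<longleftrightarrow>
     U \<in> carrier_mat n n \<and> U\<^sup>T * U = 1\<^sub>m n \<and>
     L = U * mat_diag n lam * U\<^sup>T \<and>
     lam 0 = 0 \<and> (1 < n \<longrightarrow> 0 < lam 1) \<and>
     (\<forall>i j. 1 \<le> i \<and> i \<le> j \<and> j < n \<longrightarrow> lam i \<le> lam j)"

definition first_cols :: "nat \<Rightarrow> real mat \<Rightarrow> real mat" where
  "first_cols K U = mat (dim_row U) K (\<lambda>(i, l). U $$ (i, l))"

definition eigvec_at :: "nat \<Rightarrow> (nat \<Rightarrow> 'v) \<Rightarrow> real mat \<Rightarrow> nat \<Rightarrow> 'v \<Rightarrow> real" where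
  "eigvec_at n vtx U l v = U $$ (the_inv_into {..<n} vtx v, l)"

definition diffused_state :: "real mat \<Rightarrow> real vec \<Rightarrow> real \<Rightarrow> real vec" where
  "diffused_state L x0 t = mat_exp ((- t) \<cdot>\<^sub>m L) *\<^sub>v x0"

definition target_functional :: "real mat \<Rightarrow> real \<Rightarrow> real vec \<Rightarrow> real vec \<Rightarrow> real" where
  "target_functional L \<tau> c x0 = c \<bullet> diffused_state L x0 \<tau>"

definition target_vec ::
  "nat \<Rightarrow> real mat \<Rightarrow> (nat \<Rightarrow> real) \<Rightarrow> real \<Rightarrow> real vec \<Rightarrow> real vec" where
  "target_vec K U lam \<tau> c =
     mat_exp ((- \<tau>) \<cdot>\<^sub>m mat_diag K lam) *\<^sub>v ((first_cols K U)\<^sup>T *\<^sub>v c)"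

text \<open>
  The list \<open>ts\<close> contains the observation times, so \<open>r = length ts\<close>, and time and
  eigenvalue indices start at \<open>0\<close>.
\<close>

definition measurement_block ::
  "nat \<Rightarrow> (nat \<Rightarrow> 'v) \<Rightarrow> real mat \<Rightarrow> (nat \<Rightarrow> real) \<Rightarrow> nat \<Rightarrow> real list \<Rightarrow> 'v \<Rightarrow> real mat" where
  "measurement_block n vtx U lam K ts v =
     mat (length ts) K (\<lambda>(j, l). exp (- (ts ! j) * lam l) * eigvec_at n vtx U l v)"

text \<open>The list \<open>vs\<close> enumerates the observed vertices in the order of stacking.\<close>

definition measurement_mat ::
  "nat \<Rightarrow> (nat \<Rightarrow> 'v) \<Rightarrow> real mat \<Rightarrow> (nat \<Rightarrow> real) \<Rightarrow> nat \<Rightarrow> real list \<Rightarrow> 'v list \<Rightarrow> real mat" where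
  "measurement_mat n vtx U lam K ts vs =
     foldr (\<lambda>v B. measurement_block n vtx U lam K ts v @\<^sub>r B) vs (0\<^sub>m 0 K)"

end

theory Submission
  imports Defs
begin

text \<open>
  From \<open>L U\<^sub>K = U\<^sub>K \<Lambda>\<^sub>K\<close> the exponential series gives
  \<open>exp (- \<tau> L) U\<^sub>K = U\<^sub>K exp (- \<tau> \<Lambda>\<^sub>K)\<close>, so the target functional at
  \<open>U\<^sub>K \<alpha>\<close> is \<open>g \<bullet> \<alpha>\<close>. As \<open>w \<bullet> B \<alpha> = B\<^sup>T w \<bullet> \<alpha>\<close>, exact
  recovery for all \<open>\<alpha>\<close> means \<open>B\<^sup>T w = g\<close>.
\<close>

text \<open>An entry of \<open>A ^\<^sub>m k * A\<close> is a sum of \<open>n\<close> products, so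
  each further factor \<open>A\<close> multiplies the bound by at most \<open>n * M\<close>. The
  geometric growth is what the factorials in the exponential series have to beat.\<close>

lemma pow_mat_entry_bound:
  fixes A :: "real mat"
  assumes A: "A \<in> carrier_mat n n"
    and M: "\<And>i j. i < n \<Longrightarrow> j < n \<Longrightarrow> \<bar>A $$ (i, j)\<bar> \<le> M"
    and ij: "i < n" "j < n"
  shows "\<bar>(A ^\<^sub>m k) $$ (i, j)\<bar> \<le> (real n * M) ^ k"
  using ij
proof (induction k arbitrary: i j)
  case 0
  then show ?case using A by simp
next
  case (Suc k)
  \<comment> \<open>Nonnegativity of \<open>M\<close> comes from the bound at the given index pair;
    \<open>mult_mono\<close> needs it for the power of \<open>real n * M\<close>.\<close>
  have M0: "0 \<le> M" using M[OF Suc.prems] by linarith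
  have Ak: "A ^\<^sub>m k \<in> carrier_mat n n" using A by simp
  have "(A ^\<^sub>m Suc k) $$ (i, j) = (\<Sum>l = 0..<n. (A ^\<^sub>m k) $$ (i, l) * A $$ (l, j))"
    using A Ak Suc.prems by (simp add: scalar_prod_def)
  also have "\<bar>\<dots>\<bar> \<le> (\<Sum>l = 0..<n. \<bar>(A ^\<^sub>m k) $$ (i, l) * A $$ (l, j)\<bar>)"
    by (rule sum_abs)
  also have "\<dots> \<le> (\<Sum>l = 0..<n. (real n * M) ^ k * M)"
    unfolding abs_mult
    by (intro sum_mono mult_mono) (use Suc M M0 in auto)
  also have "\<dots> = (real n * M) ^ Suc k" by simp
  finally show ?case .
qed

text \<open>Comparison with the scalar exponential series at \<open>n * M\<close>, where
  \<open>M\<close> is the largest absolute value of an entry. Convergence is what later allows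
  finite sums and the series to be interchanged.\<close>

lemma summable_mat_exp:
  fixes A :: "real mat"
  assumes A: "A \<in> carrier_mat n n" and ij: "i < n" "j < n"
  shows "summable (\<lambda>k. (A ^\<^sub>m k) $$ (i, j) / fact k)"
proof -
  define M where "M = Max ((\<lambda>(i, j). \<bar>A $$ (i, j)\<bar>) ` ({..<n} \<times> {..<n}))"
  have M: "\<bar>A $$ (i, j)\<bar> \<le> M" if "i < n" "j < n" for i j
    unfolding M_def using that by (intro Max_ge) auto
  show ?thesis
  proof (rule summable_comparison_test')
    show "summable (\<lambda>k. inverse (fact k) * (real n * M) ^ k)"
      by (rule summable_exp)
    show "norm ((A ^\<^sub>m k) $$ (i, j) / fact k) \<le> inverse (fact k) * (real n * M) ^ k"
      if "0 \<le> k" for k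
      using pow_mat_entry_bound[OF A M ij, of k]
      by (simp add: abs_divide field_simps)
  qed
qed

lemma mat_exp_carrier [simp]: "A \<in> carrier_mat n n \<Longrightarrow> mat_exp A \<in> carrier_mat n n"
  by (auto simp: mat_exp_def)

text \<open>Each factor \<open>A\<close> next to \<open>P\<close> passes through it and turns into a
  factor \<open>D\<close> on the other side. \<open>P\<close> may be rectangular, as needed for a
  matrix made of only the first \<open>K\<close> eigenvectors.\<close>

lemma pow_mat_intertwine:
  fixes A :: "'a :: semiring_1 mat"
  assumes A: "A \<in> carrier_mat n n" and D: "D \<in> carrier_mat m m"
    and P: "P \<in> carrier_mat n m" and AP: "A * P = P * D"
  shows "A ^\<^sub>m k * P = P * D ^\<^sub>m k"
proof (induction k)
  case 0
  then show ?case using A D P by simp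
next
  case (Suc k)
  have Ak: "A ^\<^sub>m k \<in> carrier_mat n n" and Dk: "D ^\<^sub>m k \<in> carrier_mat m m"
    using A D by simp_all
  have "A ^\<^sub>m Suc k * P = A ^\<^sub>m k * P * D"
    using assoc_mult_mat[OF Ak A P] assoc_mult_mat[OF Ak P D] AP by simp
  also have "\<dots> = P * D ^\<^sub>m Suc k"
    using assoc_mult_mat[OF P Dk D] Suc by simp
  finally show ?case .
qed

lemma transpose_pow_mat:
  fixes A :: "'a :: comm_semiring_1 mat"
  assumes A: "A \<in> carrier_mat n n"
  shows "(A ^\<^sub>m k)\<^sup>T = A\<^sup>T ^\<^sub>m k"
proof (induction k)
  case 0
  then show ?case using A by simp
next
  case (Suc k)
  have Ak: "A ^\<^sub>m k \<in> carrier_mat n n" and AT: "A\<^sup>T \<in> carrier_mat n n" using A by simp_all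
  have "(A ^\<^sub>m Suc k)\<^sup>T = A\<^sup>T * A\<^sup>T ^\<^sub>m k"
    using transpose_mult[OF Ak A] Suc by simp
  \<comment> \<open>Powers gain factors on the right, while transposition has put the new factor on
    the left. Intertwining with all three matrices equal to \<open>A\<^sup>T\<close> says that it
    commutes with the power.\<close>
  then show ?case by (simp add: pow_mat_intertwine[OF AT AT AT refl])
qed

lemma transpose_mat_exp:
  assumes A: "A \<in> carrier_mat n n"
  shows "(mat_exp A)\<^sup>T = mat_exp A\<^sup>T"
proof (rule eq_matI)
  fix i j assume "i < dim_row (mat_exp A\<^sup>T)" "j < dim_col (mat_exp A\<^sup>T)"
  then have ij: "i < n" "j < n" using A by (auto simp: mat_exp_def)
  have "(A ^\<^sub>m k) $$ (j, i) = (A\<^sup>T ^\<^sub>m k) $$ (i, j)" for k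
    using A ij by (simp flip: transpose_pow_mat[OF A])
  then show "(mat_exp A)\<^sup>T $$ (i, j) = mat_exp A\<^sup>T $$ (i, j)"
    using A ij by (simp add: mat_exp_def)
qed (use A in \<open>auto simp: mat_exp_def\<close>)

text \<open>The relation passes from \<open>A\<close> and \<open>D\<close> to all their powers,
  hence to the series term by term. Multiplication by \<open>P\<close> is a finite sum in each
  entry, so it can be moved into and out of the series.\<close>

lemma mat_exp_intertwine:
  assumes A: "A \<in> carrier_mat n n" and D: "D \<in> carrier_mat m m"
    and P: "P \<in> carrier_mat n m" and AP: "A * P = P * D"
  shows "mat_exp A * P = P * mat_exp D"
proof (rule eq_matI)
  fix i j assume "i < dim_row (P * mat_exp D)" "j < dim_col (P * mat_exp D)"
  then have ij: "i < n" "j < m" using D P by (auto simp: mat_exp_def)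
  have "(mat_exp A * P) $$ (i, j)
      = (\<Sum>l = 0..<n. (\<Sum>k. (A ^\<^sub>m k) $$ (i, l) / fact k) * P $$ (l, j))"
    using A P ij by (simp add: mat_exp_def scalar_prod_def)
  also have "\<dots> = (\<Sum>k. \<Sum>l = 0..<n. (A ^\<^sub>m k) $$ (i, l) / fact k * P $$ (l, j))"
    \<comment> \<open>The deleted simp rule would absorb the factor from \<open>P\<close> into the
      numerator and destroy the form that \<open>suminf_mult2\<close> and
      \<open>summable_mult2\<close> expect.\<close>
    using ij by (subst suminf_sum)
      (auto simp: suminf_mult2 summable_mat_exp[OF A]
        simp del: times_divide_eq_left intro!: summable_mult2)
  also have "(\<lambda>k. \<Sum>l = 0..<n. (A ^\<^sub>m k) $$ (i, l) / fact k * P $$ (l, j))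
      = (\<lambda>k. (A ^\<^sub>m k * P) $$ (i, j) / fact k)"
    using A P ij by (auto simp: scalar_prod_def sum_divide_distrib)
  also have "\<dots> = (\<lambda>k. (P * D ^\<^sub>m k) $$ (i, j) / fact k)"
    by (simp add: pow_mat_intertwine[OF A D P AP])
  also have "\<dots> = (\<lambda>k. \<Sum>l = 0..<m. P $$ (i, l) * ((D ^\<^sub>m k) $$ (l, j) / fact k))"
    using D P ij by (auto simp: scalar_prod_def sum_divide_distrib)
  also have "suminf \<dots> = (\<Sum>l = 0..<m. P $$ (i, l) * (\<Sum>k. (D ^\<^sub>m k) $$ (l, j) / fact k))"
    using ij by (subst suminf_sum)
      (auto simp: suminf_mult summable_mat_exp[OF D]
        simp del: times_divide_eq_right intro!: summable_mult)
  also have "\<dots> = (P * mat_exp D) $$ (i, j)"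
    using D P ij by (simp add: mat_exp_def scalar_prod_def)
  finally show "(mat_exp A * P) $$ (i, j) = (P * mat_exp D) $$ (i, j)" .
qed (use A D P in \<open>auto simp: mat_exp_def\<close>)

lemma eigendecomposition_carrier:
  assumes "ordered_eigendecomposition n L U lam"
  shows "L \<in> carrier_mat n n" "U \<in> carrier_mat n n"
proof -
  show U: "U \<in> carrier_mat n n" using assms by (simp add: ordered_eigendecomposition_def)
  have "L = U * mat_diag n lam * U\<^sup>T" using assms by (simp add: ordered_eigendecomposition_def)
  moreover have "\<dots> \<in> carrier_mat n n" using U by (intro mult_carrier_mat[where n = n]) auto
  ultimately show "L \<in> carrier_mat n n" by metis
qed

text \<open>Orthogonality gives \<open>L * U = U * mat_diag n lam\<close>. Since the right factor is
  diagonal, this is one equation per column of \<open>U\<close>, and the first \<open>K\<close> of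
  them are the claim.\<close>

lemma eigendecomposition_first_cols:
  assumes eigen: "ordered_eigendecomposition n L U lam" and K: "K \<le> n"
  shows "L * first_cols K U = first_cols K U * mat_diag K lam"
proof -
  have Lc: "L \<in> carrier_mat n n" and U: "U \<in> carrier_mat n n"
    using eigendecomposition_carrier[OF eigen] .
  have UU: "U\<^sup>T * U = 1\<^sub>m n" and L: "L = U * mat_diag n lam * U\<^sup>T"
    using eigen by (simp_all add: ordered_eigendecomposition_def)
  have UD: "U * mat_diag n lam \<in> carrier_mat n n"
    using U by (intro mult_carrier_mat[where n = n]) auto
  have "L * U = U * mat_diag n lam * (U\<^sup>T * U)"
    unfolding L by (rule assoc_mult_mat[OF UD _ U]) (use U in simp)
  then have "L * U = U * mat_diag n lam"
    unfolding UU right_mult_one_mat[OF UD] .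
  then have LU: "(L * U) $$ (i, l) = U $$ (i, l) * lam l" if "i < n" "l < n" for i l
    using that U by (simp add: mat_diag_mult_right[OF U] del: index_mult_mat)
  show ?thesis
  proof (rule eq_matI)
    fix i l
    assume "i < dim_row (first_cols K U * mat_diag K lam)"
      "l < dim_col (first_cols K U * mat_diag K lam)"
    then have il: "i < n" "l < K"
      using U by (auto simp: first_cols_def mat_diag_def)
    have P: "first_cols K U \<in> carrier_mat n K" using U by (simp add: first_cols_def)
    \<comment> \<open>Column \<open>l\<close> of a product depends on its right factor only through
      column \<open>l\<close>, so truncating \<open>U\<close> does not change the entry.\<close>
    have "col (first_cols K U) l = col U l"
      using il U K by (intro eq_vecI) (auto simp: first_cols_def)
    then have "(L * first_cols K U) $$ (i, l) = (L * U) $$ (i, l)"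
      using il U Lc K P by simp
    also have "\<dots> = first_cols K U $$ (i, l) * lam l"
      using LU il K U by (simp add: first_cols_def del: index_mult_mat)
    also have "\<dots> = (first_cols K U * mat_diag K lam) $$ (i, l)"
      using il by (simp add: mat_diag_mult_right[OF P] del: index_mult_mat)
    finally show "(L * first_cols K U) $$ (i, l) = (first_cols K U * mat_diag K lam) $$ (i, l)" .
  qed (use U Lc in \<open>auto simp: first_cols_def mat_diag_def\<close>)
qed

text \<open>Intertwining replaces the exponential of the \<open>n\<close> by \<open>n\<close>
  Laplacian by that of a \<open>K\<close> by \<open>K\<close> diagonal matrix; taking adjoints then
  moves everything from \<alpha> onto \<open>c\<close>. The diagonal exponential is its own
  transpose, which yields the form used in \<open>target_vec\<close>.\<close>

lemma target_functional_first_cols: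
  assumes eigen: "ordered_eigendecomposition n L U lam" and K: "K \<le> n"
    and c: "c \<in> carrier_vec n" and \<alpha>: "\<alpha> \<in> carrier_vec K"
  shows "target_functional L \<tau> c (first_cols K U *\<^sub>v \<alpha>) = target_vec K U lam \<tau> c \<bullet> \<alpha>"
proof -
  define P where "P = first_cols K U"
  define A where "A = (- \<tau>) \<cdot>\<^sub>m L"
  define D where "D = (- \<tau>) \<cdot>\<^sub>m mat_diag K lam"
  have P: "P \<in> carrier_mat n K" and L: "L \<in> carrier_mat n n"
    using eigendecomposition_carrier[OF eigen] by (simp_all add: P_def first_cols_def)
  have A: "A \<in> carrier_mat n n" and D: "D \<in> carrier_mat K K"
    using L by (simp_all add: A_def D_def)
  have "A * P = (- \<tau>) \<cdot>\<^sub>m (P * mat_diag K lam)"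
    unfolding A_def using L P eigendecomposition_first_cols[OF eigen K]
    by (simp add: P_def mult_smult_assoc_mat)
  also have "\<dots> = P * D"
    unfolding D_def by (rule mult_smult_distrib[OF P mat_diag_dim, symmetric])
  finally have AP: "A * P = P * D" .
  have DT: "D\<^sup>T = D" by (rule eq_matI) (auto simp: D_def mat_diag_def)
  have PTc: "P\<^sup>T *\<^sub>v c \<in> carrier_vec K"
    by (rule mult_mat_vec_carrier[OF _ c]) (use P in simp)
  have eA: "mat_exp A \<in> carrier_mat n n" and eD: "mat_exp D \<in> carrier_mat K K"
    using A D by simp_all
  have "c \<bullet> (mat_exp A *\<^sub>v (P *\<^sub>v \<alpha>)) = c \<bullet> (P *\<^sub>v (mat_exp D *\<^sub>v \<alpha>))"
    using assoc_mult_mat_vec[OF eA P \<alpha>] assoc_mult_mat_vec[OF P eD \<alpha>]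
      mat_exp_intertwine[OF A D P AP] by simp
  also have "\<dots> = (P\<^sup>T *\<^sub>v c) \<bullet> (mat_exp D *\<^sub>v \<alpha>)"
    by (rule transpose_vec_mult_scalar[OF P mult_mat_vec_carrier[OF eD \<alpha>] c, symmetric])
  also have "\<dots> = ((mat_exp D)\<^sup>T *\<^sub>v (P\<^sup>T *\<^sub>v c)) \<bullet> \<alpha>"
    by (rule transpose_vec_mult_scalar[OF eD \<alpha> PTc, symmetric])
  also have "(mat_exp D)\<^sup>T = mat_exp D"
    unfolding transpose_mat_exp[OF D] DT ..
  finally show ?thesis
    by (simp add: target_functional_def diffused_state_def target_vec_def A_def D_def P_def)
qed

lemma measurement_mat_carrier:
  "measurement_mat n vtx U lam K ts vs \<in> carrier_mat (length ts * length vs) K"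
proof (induction vs)
  case Nil
  then show ?case by (simp add: measurement_mat_def)
next
  case (Cons v vs)
  have "measurement_block n vtx U lam K ts v \<in> carrier_mat (length ts) K"
    by (simp add: measurement_block_def)
  from carrier_append_rows[OF this Cons] show ?case
    by (simp add: measurement_mat_def)
qed

text \<open>Testing against the unit vectors reads off the coordinates. This turns recovery for
  every \<alpha> into a single vector equation.\<close>

lemma scalar_prod_eq_iff:
  fixes x y :: "'a :: semiring_1 vec"
  assumes x: "x \<in> carrier_vec m" and y: "y \<in> carrier_vec m"
  shows "(\<forall>\<alpha> \<in> carrier_vec m. x \<bullet> \<alpha> = y \<bullet> \<alpha>) \<longleftrightarrow> x = y"
proof
  assume eq: "\<forall>\<alpha> \<in> carrier_vec m. x \<bullet> \<alpha> = y \<bullet> \<alpha>"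
  show "x = y"
  proof (rule eq_vecI)
    fix i assume "i < dim_vec y"
    then have "i < m" using y by simp
    then show "x $ i = y $ i"
      using eq[rule_format, of "unit_vec m i"] x y by simp
  qed (use x y in simp)
qed simp

theorem proposition2p1:
  fixes V S :: "'v set" and E :: "'v set set" and \<omega> :: "'v set \<Rightarrow> real"
    and vtx :: "nat \<Rightarrow> 'v" and vs :: "'v list"
    and n K :: nat and L U B :: "real mat" and lam :: "nat \<Rightarrow> real"
    and \<tau> :: real and ts :: "real list" and c g :: "real vec"
  assumes graph: "connected_graph V E"
    and weights: "\<forall>e\<in>E. \<omega> e > 0"
    and n: "n = card V"
    and numbering: "bij_betw vtx {..<n} V"
    and L: "L = laplacian_mat n vtx E \<omega>"
    and eigen: "ordered_eigendecomposition n L U lam"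
    and K: "1 \<le> K" "K \<le> n"
    and horizon: "\<tau> > 0"
    and times: "sorted_wrt (<) ts" "\<forall>t\<in>set ts. 0 \<le> t \<and> t < \<tau>"
    and S: "S \<subseteq> V" "distinct vs" "set vs = S"
    and B: "B = measurement_mat n vtx U lam K ts vs"
    and c: "c \<in> carrier_vec n" "\<forall>i<n. c $ i \<ge> 0" "vec n (\<lambda>_. 1) \<bullet> c = 1"
    and g: "g = target_vec K U lam \<tau> c"
  shows "((\<exists>w \<in> carrier_vec (length ts * card S). \<forall>\<alpha> \<in> carrier_vec K.
            w \<bullet> (B *\<^sub>v \<alpha>) = target_functional L \<tau> c (first_cols K U *\<^sub>v \<alpha>))
          \<longleftrightarrow> g \<in> mat_range (B\<^sup>T))
       \<and> ((\<exists>w \<in> carrier_vec (length ts * card S). \<forall>\<alpha> \<in> carrier_vec K.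
            w \<bullet> (B *\<^sub>v \<alpha>) = target_functional L \<tau> c (first_cols K U *\<^sub>v \<alpha>))
          \<longleftrightarrow> (\<exists>w \<in> carrier_vec (length ts * card S). B\<^sup>T *\<^sub>v w = g))"
proof -
  \<comment> \<open>Distinctness of \<open>vs\<close> makes the number of stacked blocks equal to
    \<open>card S\<close>, so the weight vectors have the right dimension for
    \<open>B\<^sup>T\<close>.\<close>
  have "card S = length vs" using S distinct_card by blast
  then have Bc: "B \<in> carrier_mat (length ts * card S) K"
    using measurement_mat_carrier B by simp
  have "mat_exp ((- \<tau>) \<cdot>\<^sub>m mat_diag K lam) \<in> carrier_mat K K" by simp
  moreover have "(first_cols K U)\<^sup>T *\<^sub>v c \<in> carrier_vec K"
    by (rule carrier_vecI) (simp add: first_cols_def)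
  ultimately have gc: "g \<in> carrier_vec K"
    unfolding g target_vec_def by (rule mult_mat_vec_carrier)
  \<comment> \<open>The equivalence is proved for each fixed \<open>w\<close>, so the same weights
    serve as witness on both sides of the existential statements.\<close>
  have recovery: "(\<forall>\<alpha> \<in> carrier_vec K.
        w \<bullet> (B *\<^sub>v \<alpha>) = target_functional L \<tau> c (first_cols K U *\<^sub>v \<alpha>))
      \<longleftrightarrow> B\<^sup>T *\<^sub>v w = g" if w: "w \<in> carrier_vec (length ts * card S)" for w
  proof -
    have "B\<^sup>T *\<^sub>v w \<in> carrier_vec K" using Bc by (intro carrier_vecI) simp
    from scalar_prod_eq_iff[OF this gc] show ?thesis
      using transpose_vec_mult_scalar[OF Bc _ w]
        target_functional_first_cols[OF eigen K(2) c(1)] g by simp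
  qed
  have "g \<in> mat_range B\<^sup>T \<longleftrightarrow> (\<exists>w \<in> carrier_vec (length ts * card S). B\<^sup>T *\<^sub>v w = g)"
    using Bc by (auto simp: mat_range_def)
  with recovery show ?thesis by auto
qed

end
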